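(* Let $f \in L(\mathbb{R}^2)$ be piecewise smooth and $\alpha > 0$. If $|f(x)| < C$ for all $x \in \mathbb{R}^2$, then for all $x \in \mathbb{R}^2$, $$|A_\alpha f(x)| \leq C.$$ Furthermore, if $f$ is real-valued and $A \leq f(x) \leq B$ for all $x \in \mathbb{R}^2$, then for all $x \in \mathbb{R}^2$, $$A \leq A_\alpha f(x) \leq B.$$
   Context: $L(\mathbb{R}^2)$ denotes the space of (Lebesgue) integrable functions on $\mathbb{R}^2$; functions are complex-valued unless stated otherwise. $A, B, C$ are real constants. Piecewise smooth functions: a function $f$ is a simple piecewise smooth function if $f(x) = F(x)\chi_D(x)$, where $F$ is differentiable on $\mathbb{R}^2$, $D \subset \mathbb{R}^2$ has a piecewise smooth boundary that does not intersect itself, and $\chi_D(x) = 1$ if $x \in D \cup \partial D$, $\chi_D(x) = 0$ if $x \notin D\cup\partial D$. A function is piecewise smooth if it is a finite linear combination of simple piecewise smooth functions. Radon transform: for $f\in L(\mathbb{R}^2)$, $0\le\psi<\pi$ and $t \in \mathbb{R}$, $$Rf(t,\psi) = \int_{-\infty}^\infty f(t\cos\psi - u\sin\psi,\ t\sin\psi + u\cos\psi)\, du,$$ i.e. the integral of $f$ over the line orthogonal to the unit vector $\mathbf{n} = (\cos\psi,\sin\psi)$ and passing through $t\mathbf{n}$. By Fubini's theorem it exists for almost all $\psi\in[0,\pi)$ and $t\in\mathbb{R}$. Operator $A_\alpha$: for $\alpha>0$ and $x=(x_1,x_2)\in\mathbb{R}^2$, $$A_\alpha f(x) = \int_0^\pi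 d\psi \int_{-\infty}^\infty \Phi_\alpha(x,t,\psi)\, Rf(t,\psi)\, dt,$$ $$\Phi_\alpha(x,t,\psi) = \frac{1}{2\pi^2}\,\frac{\alpha^2 - (x_1\cos\psi + x_2\sin\psi - t)^2}{[\alpha^2 + (x_1\cos\psi + x_2\sin\psi - t)^2]^2}.$$ *)

theory Defs
  imports "HOL-Analysis.Analysis"
begin

text \<open>
  The plane is \<^typ>\<open>real \<times> real\<close>.  A boundary without self-intersections is read as a finite
  disjoint union of simple curves.  The sets \<open>D\<close> need not be bounded, so besides closed curves
  the components may be curves running to infinity in both directions; the family may also be
  empty (\<open>D\<close> the whole plane).  Piecewise smooth curves are taken to be piecewise continuously
  differentiable, and for unbounded curves the breakpoints only have to be locally finite.
\<close>

definition closed_boundary_curve :: "(real \<times> real) set \<Rightarrow> bool" where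
  "closed_boundary_curve \<Gamma> \<longleftrightarrow>
     (\<exists>\<gamma>. simple_path \<gamma> \<and> pathfinish \<gamma> = pathstart \<gamma> \<and>
          \<gamma> piecewise_C1_differentiable_on {0..1} \<and> \<Gamma> = path_image \<gamma>)"

text \<open>
  Tending to infinity at both ends rules out that an injectively parametrised line comes back
  to touch itself in the limit.
\<close>

definition unbounded_boundary_curve :: "(real \<times> real) set \<Rightarrow> bool" where
  "unbounded_boundary_curve \<Gamma> \<longleftrightarrow>
     (\<exists>\<gamma> :: real \<Rightarrow> real \<times> real. inj \<gamma> \<and> filterlim \<gamma> at_infinity at_infinity \<and>
          (\<forall>a b. \<gamma> piecewise_C1_differentiable_on {a..b}) \<and> \<Gamma> = range \<gamma>)"

definition piecewise_smooth_boundary :: "(real \<times> real) set \<Rightarrow> bool" where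
  "piecewise_smooth_boundary D \<longleftrightarrow>
     (\<exists>\<C>. finite \<C> \<and> disjoint \<C> \<and>
          (\<forall>\<Gamma>\<in>\<C>. closed_boundary_curve \<Gamma> \<or> unbounded_boundary_curve \<Gamma>) \<and>
          frontier D = \<Union>\<C>)"

definition simple_piecewise_smooth :: "(real \<times> real \<Rightarrow> complex) \<Rightarrow> bool" where
  "simple_piecewise_smooth f \<longleftrightarrow>
     (\<exists>F D. F differentiable_on UNIV \<and> piecewise_smooth_boundary D \<and>
            f = (\<lambda>x. F x * indicator (D \<union> frontier D) x))"

definition piecewise_smooth :: "(real \<times> real \<Rightarrow> complex) \<Rightarrow> bool" where
  "piecewise_smooth f \<longleftrightarrow>
     (\<exists>(n::nat) (c :: nat \<Rightarrow> complex) g.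
        (\<forall>i<n. simple_piecewise_smooth (g i)) \<and> f = (\<lambda>x. \<Sum>i<n. c i * g i x))"

text \<open>
  On the null set of lines where the integral does not exist, the value is 0 by the convention
  for the Bochner integral.
\<close>

definition radon :: "(real \<times> real \<Rightarrow> complex) \<Rightarrow> real \<Rightarrow> real \<Rightarrow> complex" where
  "radon f t \<psi> =
     (LINT u|lebesgue. f (t * cos \<psi> - u * sin \<psi>, t * sin \<psi> + u * cos \<psi>))"

definition Phi :: "real \<Rightarrow> real \<times> real \<Rightarrow> real \<Rightarrow> real \<Rightarrow> real" where
  "Phi \<alpha> x t \<psi> =
     1 / (2 * pi\<^sup>2) *
     ((\<alpha>\<^sup>2 - (fst x * cos \<psi> + snd x * sin \<psi> - t)\<^sup>2) /
      (\<alpha>\<^sup>2 + (fst x * cos \<psi> + snd x * sin \<psi> - t)\<^sup>2)\<^sup>2)"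

definition A_op :: "real \<Rightarrow> (real \<times> real \<Rightarrow> complex) \<Rightarrow> real \<times> real \<Rightarrow> complex" where
  "A_op \<alpha> f x =
     (LINT \<psi>:{0..<pi}|lebesgue. (LINT t|lebesgue. complex_of_real (Phi \<alpha> x t \<psi>) * radon f t \<psi>))"

end

theory Submission
  imports Defs "HOL-Real_Asymp.Real_Asymp"
begin

text \<open>
  The operator \<open>A_\<alpha>\<close> is convolution with a probability density, so each value of \<open>A_\<alpha> f\<close> is an
  average of values of \<open>f\<close> and obeys every bound that \<open>f\<close> obeys.

  For a direction \<open>\<psi>\<close> write \<open>n = (cos \<psi>, sin \<psi>)\<close> and let \<open>\<phi>\<close> be the even function with
  \<open>\<Phi>_\<alpha>(x, t, \<psi>) = \<phi>(x \<bullet> n - t)\<close>.  A rotation of the plane by \<open>\<psi>\<close> and Fubini's theorem merge the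
  integral over the lines orthogonal to \<open>n\<close> with the integral over \<open>t\<close>:
  \<open>\<integral> \<Phi>_\<alpha>(x, t, \<psi>) Rf(t, \<psi>) dt = \<integral> \<phi>((x - y) \<bullet> n) f(y) dy\<close> over the plane
  (\<open>filtered_radon_eq_plane_integral\<close>).  Since \<open>\<phi>\<close> is bounded, the integration over \<open>\<psi>\<close> may be done
  first, which leaves the convolution of \<open>f\<close> with \<open>P(z) = \<integral>_0^\<pi> \<phi>(z \<bullet> n) d\<psi>\<close>
  (\<open>A_op_eq_poisson_convolution\<close>).

  The function \<open>\<phi>\<close> changes sign, but \<open>P\<close> is positive.  With \<open>a = z \<bullet> n\<close> and \<open>b = da/d\<psi>\<close> one has
  \<open>a\<^sup>2 + b\<^sup>2 = |z|\<^sup>2\<close>, and up to the \<open>\<psi>\<close>-derivative of a multiple of \<open>a b / (\<alpha>\<^sup>2 + a\<^sup>2)\<close> the integrand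
  \<open>\<phi>(a)\<close> equals the positive function \<open>\<alpha>\<^sup>2 / (2 \<pi>\<^sup>2 (\<alpha>\<^sup>2 + |z|\<^sup>2) (\<alpha>\<^sup>2 + a\<^sup>2))\<close>.  The derivative
  integrates to zero because \<open>a\<close> and \<open>b\<close> both change sign between \<open>0\<close> and \<open>\<pi>\<close>
  (\<open>set_integral_recon_filter_proj\<close>).

  The positive form also gives the total mass of \<open>P\<close>.  By Tonelli's theorem the plane integral may be
  done first; after rotating \<open>n\<close> to the first coordinate axis it is an iterated integral of elementary
  functions with value \<open>1 / \<pi>\<close> for every \<open>\<psi>\<close> (\<open>nn_integral_angular_poisson\<close>), so \<open>P\<close> has mass one.
\<close>

section \<open>Two integrals over the real line\<close>

lemma nn_integral_FTC_real_line:
  fixes f F :: "real \<Rightarrow> real"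
  assumes F: "\<And>x. (F has_real_derivative f x) (at x)"
    and cont: "\<And>x. isCont f x"
    and nonneg: "\<And>x. 0 \<le> f x"
    and bot: "(F \<longlongrightarrow> S) at_bot"
    and top: "(F \<longlongrightarrow> T) at_top"
  shows "(\<integral>\<^sup>+x. ennreal (f x) \<partial>lborel) = ennreal (T - S)"
proof -
  have 1: "((F \<circ> real_of_ereal) \<longlongrightarrow> S) (at_right (-\<infinity>))" "((F \<circ> real_of_ereal) \<longlongrightarrow> T) (at_left \<infinity>)"
    using bot top by (simp_all only: ereal_tendsto_simps)
  have "set_integrable lborel (einterval (-\<infinity>) \<infinity>) f" "(LBINT x=-\<infinity>..\<infinity>. f x) = T - S"
    by (rule interval_integral_FTC_nonneg[where F=F]; use F cont nonneg 1 in simp)+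
  then have "integrable lborel f" "(LINT x|lborel. f x) = T - S"
    by (simp_all add: set_integrable_def interval_lebesgue_integral_def set_lebesgue_integral_def)
  then show ?thesis
    by (simp add: nn_integral_eq_integral nonneg)
qed

lemma nn_integral_inverse_quadratic:
  fixes c :: real
  assumes "c > 0"
  shows "(\<integral>\<^sup>+u. ennreal (1 / (c\<^sup>2 + u\<^sup>2)) \<partial>lborel) = ennreal (pi / c)"
proof -
  have pos: "c\<^sup>2 + u\<^sup>2 > 0" for u
    using assms by (simp add: add_pos_nonneg)
  have "(\<integral>\<^sup>+u. ennreal (1 / (c\<^sup>2 + u\<^sup>2)) \<partial>lborel) = ennreal (pi * inverse c / 2 - - (pi * inverse c / 2))"
  proof (rule nn_integral_FTC_real_line[where F = "\<lambda>u. arctan (u / c) / c"])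
    show "((\<lambda>u. arctan (u / c) / c) has_real_derivative 1 / (c\<^sup>2 + u\<^sup>2)) (at u)" for u
    proof -
      have "((\<lambda>u. arctan (u / c) / c) has_real_derivative 1 / (1 + (u / c)\<^sup>2) * (1 / c) / c) (at u)"
        using assms by (auto intro!: derivative_eq_intros simp: inverse_eq_divide)
      moreover have "1 / (1 + (u / c)\<^sup>2) * (1 / c) / c = 1 / (c\<^sup>2 * (1 + (u / c)\<^sup>2))"
        by (simp add: power2_eq_square mult_ac)
      moreover have "c\<^sup>2 * (1 + (u / c)\<^sup>2) = c\<^sup>2 + u\<^sup>2"
        using assms by (simp add: power_divide algebra_simps)
      ultimately show ?thesis by simp
    qed
    show "isCont (\<lambda>u. 1 / (c\<^sup>2 + u\<^sup>2)) u" for u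
      using pos[of u] by (intro continuous_intros) auto
    show "((\<lambda>u. arctan (u / c) / c) \<longlongrightarrow> - (pi * inverse c / 2)) at_bot"
      using assms by real_asymp
    show "((\<lambda>u. arctan (u / c) / c) \<longlongrightarrow> pi * inverse c / 2) at_top"
      using assms by real_asymp
  qed (use pos less_imp_le in auto)
  then show ?thesis by (simp only: inverse_eq_divide) simp
qed

lemma nn_integral_inverse_cubed_hypotenuse:
  fixes c :: real
  assumes "c > 0"
  shows "(\<integral>\<^sup>+t. ennreal (1 / sqrt (c\<^sup>2 + t\<^sup>2) ^ 3) \<partial>lborel) = ennreal (2 / c\<^sup>2)"
proof -
  have pos: "c\<^sup>2 + t\<^sup>2 > 0" for t
    using assms by (simp add: add_pos_nonneg)
  have "(\<integral>\<^sup>+t. ennreal (1 / sqrt (c\<^sup>2 + t\<^sup>2) ^ 3) \<partial>lborel) = ennreal (inverse (c\<^sup>2) - - inverse (c\<^sup>2))"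
  proof (rule nn_integral_FTC_real_line[where F = "\<lambda>t. t / (c\<^sup>2 * sqrt (c\<^sup>2 + t\<^sup>2))"])
    fix t :: real
    define s where "s = sqrt (c\<^sup>2 + t\<^sup>2)"
    have s: "s > 0" "s\<^sup>2 = c\<^sup>2 + t\<^sup>2"
      using pos[of t] by (auto simp: s_def)
    have "((\<lambda>t. sqrt (c\<^sup>2 + t\<^sup>2)) has_real_derivative t / s) (at t)"
      using pos[of t] by (auto intro!: derivative_eq_intros simp: s_def field_simps)
    then have "((\<lambda>t. t / (c\<^sup>2 * sqrt (c\<^sup>2 + t\<^sup>2))) has_real_derivative
        (1 * (c\<^sup>2 * s) - t * (c\<^sup>2 * (t / s))) / ((c\<^sup>2 * s) * (c\<^sup>2 * s))) (at t)"
      using assms s(1) unfolding s_def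
      by (intro DERIV_divide DERIV_cmult DERIV_ident) auto
    moreover have "(1 * (c\<^sup>2 * s) - t * (c\<^sup>2 * (t / s))) / ((c\<^sup>2 * s) * (c\<^sup>2 * s))
        = c\<^sup>2 * (s\<^sup>2 - t\<^sup>2) / (c\<^sup>2 * c\<^sup>2 * s ^ 3)"
      using s(1) assms by (simp add: field_simps power2_eq_square power3_eq_cube)
    ultimately show "((\<lambda>t. t / (c\<^sup>2 * sqrt (c\<^sup>2 + t\<^sup>2))) has_real_derivative
        1 / sqrt (c\<^sup>2 + t\<^sup>2) ^ 3) (at t)"
      using assms s by (simp add: s_def[symmetric])
    show "isCont (\<lambda>t. 1 / sqrt (c\<^sup>2 + t\<^sup>2) ^ 3) t"
      using s(1) s_def by (intro continuous_intros) auto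
    show "0 \<le> 1 / sqrt (c\<^sup>2 + t\<^sup>2) ^ 3"
      by simp
  next
    show "((\<lambda>t. t / (c\<^sup>2 * sqrt (c\<^sup>2 + t\<^sup>2))) \<longlongrightarrow> inverse (c\<^sup>2)) at_top"
      using assms by real_asymp
    show "((\<lambda>t. t / (c\<^sup>2 * sqrt (c\<^sup>2 + t\<^sup>2))) \<longlongrightarrow> - inverse (c\<^sup>2)) at_bot"
      using assms by real_asymp
  qed
  then show ?thesis by (simp only: inverse_eq_divide) simp
qed

section \<open>Rotation invariance of Lebesgue measure on the plane\<close>

definition rotation :: "real \<Rightarrow> real \<times> real \<Rightarrow> real \<times> real" where
  "rotation \<psi> p = (fst p * cos \<psi> - snd p * sin \<psi>, fst p * sin \<psi> + snd p * cos \<psi>)"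

lemma measurable_rotation [measurable]: "rotation \<psi> \<in> borel_measurable borel"
  unfolding rotation_def[abs_def] borel_prod[symmetric] by measurable

text \<open>
  On each horizontal line a horizontal shear is a translation.
\<close>

lemma lborel_horizontal_shear:
  "distr lborel borel (\<lambda>p :: real \<times> real. (fst p + c * snd p, snd p)) = lborel" (is "distr _ _ ?S = _")
proof (rule measure_eqI)
  fix X :: "(real \<times> real) set" assume "X \<in> sets (distr lborel borel ?S)"
  then have [measurable]: "X \<in> sets borel" by simp
  have [measurable]: "?S \<in> borel_measurable borel"
    unfolding borel_prod[symmetric] by measurable
  have [measurable]: "indicator X \<in> borel_measurable (lborel \<Otimes>\<^sub>M lborel)"
     "(\<lambda>p. indicator X (?S p)) \<in> borel_measurable (lborel \<Otimes>\<^sub>M lborel)" 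
    unfolding lborel_prod by measurable
  have "emeasure (distr lborel borel ?S) X = (\<integral>\<^sup>+p. indicator X (?S p) \<partial>lborel)"
    by (subst nn_integral_distr[symmetric, of ?S lborel borel]) auto
  also have "\<dots> = (\<integral>\<^sup>+u. \<integral>\<^sup>+t. indicator X (c * u + t, u) \<partial>lborel \<partial>lborel)"
    by (subst lborel_prod[symmetric], subst lborel_pair.nn_integral_snd[symmetric]) (auto simp: add.commute)
  also have "\<dots> = (\<integral>\<^sup>+u. \<integral>\<^sup>+t. indicator X (t, u) \<partial>lborel \<partial>lborel)"
  proof (rule nn_integral_cong)
    fix u :: real
    have [measurable]: "(\<lambda>t. (t, u)) \<in> borel_measurable borel"
      by (intro borel_measurable_continuous_onI continuous_intros)
    show "(\<integral>\<^sup>+t. indicator X (c * u + t, u) \<partial>lborel) = (\<integral>\<^sup>+t. indicator X (t, u) \<partial>lborel)"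
      using nn_integral_real_affine[of "\<lambda>t. indicator X (t, u)" 1 "c * u"] by simp
  qed
  also have "\<dots> = emeasure lborel X"
    by (subst lborel_pair.nn_integral_snd) (auto simp: lborel_prod)
  finally show "emeasure (distr lborel borel ?S) X = emeasure lborel X" .
qed simp

lemma lborel_swap:
  "distr lborel borel (\<lambda>p :: real \<times> real. (snd p, fst p)) = lborel"
proof -
  have "distr lborel borel (\<lambda>p :: real \<times> real. (snd p, fst p)) = distr lborel lborel (\<lambda>(x, y). (y, x))"
    by (intro distr_cong) auto
  also have "\<dots> = lborel"
    using lborel_pair.distr_pair_swap[where 'a=real and 'b=real] by (simp only: lborel_prod)
  finally show ?thesis .
qed

lemma distr_lborel_compose:
  assumes "f \<in> borel_measurable borel" "g \<in> borel_measurable borel"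
  shows "distr (distr lborel borel f) borel g = distr lborel borel (g \<circ> f)"
  using assms by (intro distr_distr) auto

text \<open>
  A vertical shear is a horizontal one conjugated by the exchange of coordinates.
\<close>

lemma lborel_vertical_shear:
  "distr lborel borel (\<lambda>p :: real \<times> real. (fst p, snd p + c * fst p)) = lborel"
proof -
  have [measurable]: "(\<lambda>p :: real \<times> real. (snd p, fst p)) \<in> borel_measurable borel"
    "(\<lambda>p :: real \<times> real. (fst p + c * snd p, snd p)) \<in> borel_measurable borel"
    unfolding borel_prod[symmetric] by measurable
  have "lborel = distr (distr (distr lborel borel (\<lambda>p :: real \<times> real. (snd p, fst p)))
     borel (\<lambda>p. (fst p + c * snd p, snd p))) borel (\<lambda>p. (snd p, fst p))"
    by (simp only: lborel_swap lborel_horizontal_shear)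
  also have "\<dots> = distr lborel borel (\<lambda>p :: real \<times> real. (fst p, snd p + c * fst p))"
    by (subst distr_lborel_compose, measurable, subst distr_lborel_compose, measurable) (simp add: o_def)
  finally show ?thesis ..
qed

text \<open>
  A rotation by \<open>\<psi>\<close> is the product of three shears: a horizontal one with factor \<open>- tan (\<psi> / 2)\<close>, a
  vertical one with factor \<open>sin \<psi>\<close>, and the first one again.  The tangent is finite since
  \<open>\<psi> / 2\<close> lies in \<open>[0, \<pi> / 2)\<close>.
\<close>

lemma lborel_rotation:
  assumes "0 \<le> \<psi>" "\<psi> < pi"
  shows "distr lborel borel (rotation \<psi>) = lborel"
proof -
  have [measurable]: "(\<lambda>p :: real \<times> real. (fst p, snd p + c * fst p)) \<in> borel_measurable borel"
    "(\<lambda>p :: real \<times> real. (fst p + c * snd p, snd p)) \<in> borel_measurable borel" for c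
    unfolding borel_prod[symmetric] by measurable
  have "cos (\<psi> / 2) > 0"
    using assms by (intro cos_gt_zero_pi) auto
  then have tan: "tan (\<psi> / 2) * sin \<psi> = 1 - cos \<psi>" "tan (\<psi> / 2) * (1 + cos \<psi>) = sin \<psi>"
    using sin_double[of "\<psi> / 2"] cos_double_cos[of "\<psi> / 2"] cos_double_sin[of "\<psi> / 2"]
    by (auto simp: tan_def field_simps power2_eq_square)
  let ?H = "\<lambda>p :: real \<times> real. (fst p + - tan (\<psi> / 2) * snd p, snd p)"
  have "lborel = distr (distr (distr lborel borel ?H)
     borel (\<lambda>p. (fst p, snd p + sin \<psi> * fst p))) borel ?H"
    by (simp only: lborel_vertical_shear lborel_horizontal_shear)
  also have "\<dots> = distr lborel borel (?H \<circ> (\<lambda>p. (fst p, snd p + sin \<psi> * fst p)) \<circ> ?H)"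
    by (subst distr_lborel_compose, measurable, subst distr_lborel_compose, measurable) (simp only: o_assoc)
  also have "?H \<circ> (\<lambda>p. (fst p, snd p + sin \<psi> * fst p)) \<circ> ?H = rotation \<psi>"
  proof
    fix p :: "real \<times> real"
    show "(?H \<circ> (\<lambda>p. (fst p, snd p + sin \<psi> * fst p)) \<circ> ?H) p = rotation \<psi> p"
      using tan unfolding rotation_def o_def fst_conv snd_conv prod.inject by algebra
  qed
  finally show ?thesis ..
qed

section \<open>The reconstruction filter and its average over all directions\<close>

lemma borel_measurable_fst_prod [measurable]: "fst \<in> borel_measurable (borel :: (real \<times> real) measure)"
  by (intro borel_measurable_continuous_onI continuous_intros)

lemma borel_measurable_snd_prod [measurable]: "snd \<in> borel_measurable (borel :: (real \<times> real) measure)"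
  by (intro borel_measurable_continuous_onI continuous_intros)

definition proj :: "real \<Rightarrow> real \<times> real \<Rightarrow> real" where
  "proj \<psi> x = fst x * cos \<psi> + snd x * sin \<psi>"

lemma proj_rotation [simp]: "proj \<psi> (rotation \<psi> p) = fst p"
proof -
  have "(cos \<psi>)\<^sup>2 + (sin \<psi>)\<^sup>2 = 1" by simp
  then show ?thesis
    unfolding proj_def rotation_def fst_conv snd_conv by algebra
qed

lemma norm_rotation [simp]: "norm (rotation \<psi> p) = norm p"
proof -
  have "(cos \<psi>)\<^sup>2 + (sin \<psi>)\<^sup>2 = 1" by simp
  then have "(fst p * cos \<psi> - snd p * sin \<psi>)\<^sup>2 + (fst p * sin \<psi> + snd p * cos \<psi>)\<^sup>2 = (fst p)\<^sup>2 + (snd p)\<^sup>2"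
    by algebra
  then show ?thesis
    by (simp add: norm_prod_def rotation_def)
qed

definition recon_filter :: "real \<Rightarrow> real \<Rightarrow> real" where
  "recon_filter \<alpha> s = 1 / (2 * pi\<^sup>2) * ((\<alpha>\<^sup>2 - s\<^sup>2) / (\<alpha>\<^sup>2 + s\<^sup>2)\<^sup>2)"

lemma Phi_eq_recon_filter: "Phi \<alpha> x t \<psi> = recon_filter \<alpha> (proj \<psi> x - t)"
  by (simp add: Phi_def recon_filter_def proj_def)

lemma proj_diff: "proj \<psi> (x - y) = proj \<psi> x - proj \<psi> y"
  by (simp add: proj_def algebra_simps)

lemma borel_measurable_recon_filter [measurable]: "recon_filter \<alpha> \<in> borel_measurable borel"
  unfolding recon_filter_def[abs_def] by measurable

lemma borel_measurable_proj [measurable]: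
  "case_prod proj \<in> borel_measurable (borel \<Otimes>\<^sub>M borel)"
  unfolding proj_def[abs_def] by measurable

lemma borel_measurable_proj_right [measurable]:
  "proj \<psi> \<in> borel_measurable borel"
  unfolding proj_def[abs_def] by measurable

lemma abs_recon_filter_le:
  assumes "\<alpha> > 0"
  shows "\<bar>recon_filter \<alpha> s\<bar> \<le> 1 / (2 * pi\<^sup>2 * \<alpha>\<^sup>2)"
proof -
  have pos: "\<alpha>\<^sup>2 > 0" "\<alpha>\<^sup>2 + s\<^sup>2 > 0" using assms by (auto simp: add_pos_nonneg)
  have "\<bar>\<alpha>\<^sup>2 - s\<^sup>2\<bar> / (\<alpha>\<^sup>2 + s\<^sup>2)\<^sup>2 \<le> (\<alpha>\<^sup>2 + s\<^sup>2) / (\<alpha>\<^sup>2 + s\<^sup>2)\<^sup>2"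
    by (intro divide_right_mono) (auto simp: abs_le_iff)
  also have "\<dots> = 1 / (\<alpha>\<^sup>2 + s\<^sup>2)"
    using pos by (simp add: power2_eq_square)
  also have "\<dots> \<le> 1 / \<alpha>\<^sup>2"
    using pos by (intro divide_left_mono) auto
  finally have "1 / (2 * pi\<^sup>2) * (\<bar>\<alpha>\<^sup>2 - s\<^sup>2\<bar> / (\<alpha>\<^sup>2 + s\<^sup>2)\<^sup>2) \<le> 1 / (2 * pi\<^sup>2) * (1 / \<alpha>\<^sup>2)"
    by (intro mult_left_mono) auto
  then show ?thesis
    by (simp add: recon_filter_def abs_mult abs_divide)
qed

text \<open>
  The part of the filtered direction \<open>\<psi>\<close> that survives integration over \<open>\<psi>\<close>; unlike the filter
  itself it is nonnegative.
\<close>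

definition angular_poisson :: "real \<Rightarrow> real \<times> real \<Rightarrow> real \<Rightarrow> real" where
  "angular_poisson \<alpha> z \<psi> = \<alpha>\<^sup>2 / (2 * pi\<^sup>2 * (\<alpha>\<^sup>2 + (norm z)\<^sup>2) * (\<alpha>\<^sup>2 + (proj \<psi> z)\<^sup>2))"

lemma borel_measurable_angular_poisson [measurable]:
  "(\<lambda>(z, \<psi>). angular_poisson \<alpha> z \<psi>) \<in> borel_measurable (borel \<Otimes>\<^sub>M borel)"
  unfolding angular_poisson_def[abs_def] by measurable

lemma angular_poisson_nonneg [simp]: "0 \<le> angular_poisson \<alpha> z \<psi>"
  by (simp add: angular_poisson_def)

text \<open>
  For \<open>\<alpha> > 0\<close> this is the Poisson kernel of the half-space above the plane at height \<open>\<alpha>\<close>, that is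
  \<open>\<alpha> / (2 \<pi> (\<alpha>\<^sup>2 + |z|\<^sup>2)\<^bsup>3/2\<^esup>)\<close>.  The integral representation shows positivity at once and makes the
  total mass accessible by rotating each direction into a coordinate axis.
\<close>

definition poisson_kernel :: "real \<Rightarrow> real \<times> real \<Rightarrow> real" where
  "poisson_kernel \<alpha> z = (LINT \<psi>:{0..<pi}|lborel. angular_poisson \<alpha> z \<psi>)"

lemma poisson_kernel_nonneg: "0 \<le> poisson_kernel \<alpha> z"
  unfolding poisson_kernel_def set_lebesgue_integral_def
  by (intro Bochner_Integration.integral_nonneg) auto

lemma borel_measurable_poisson_kernel [measurable]: "poisson_kernel \<alpha> \<in> borel_measurable borel"
  unfolding poisson_kernel_def[abs_def] set_lebesgue_integral_def
  by measurable

lemma set_integral_drop_right_endpoint: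
  fixes h :: "real \<Rightarrow> real"
  shows "(LINT \<psi>:{0..<b}|lborel. h \<psi>) = (LINT \<psi>:{0..b}|lborel. h \<psi>)"
  by (rule set_integral_discrete_difference[of "{b}"]) auto

text \<open>
  The filter and \<open>angular_poisson\<close> differ by the derivative of a function of \<open>\<psi>\<close> with equal values at
  \<open>0\<close> and \<open>\<pi>\<close>, so the directional average of the sign-changing filter is positive.
\<close>

lemma set_integral_recon_filter_proj:
  assumes "\<alpha> > 0"
  shows "(LINT \<psi>:{0..<pi}|lborel. recon_filter \<alpha> (proj \<psi> z)) = poisson_kernel \<alpha> z"
proof -
  define a b where "a = (\<lambda>\<psi>. proj \<psi> z)" and "b = (\<lambda>\<psi>. snd z * cos \<psi> - fst z * sin \<psi>)"
  have pos: "\<alpha>\<^sup>2 + (a \<psi>)\<^sup>2 > 0" "\<alpha>\<^sup>2 + (norm z)\<^sup>2 > 0" for \<psi>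
    using assms by (auto simp: add_pos_nonneg)
  have nz: "(norm z)\<^sup>2 = (fst z)\<^sup>2 + (snd z)\<^sup>2"
    by (simp add: norm_prod_def)
  have pyth: "(b \<psi>)\<^sup>2 = (norm z)\<^sup>2 - (a \<psi>)\<^sup>2" for \<psi>
  proof -
    have "(cos \<psi>)\<^sup>2 + (sin \<psi>)\<^sup>2 = 1" by simp
    then show ?thesis
      unfolding nz a_def b_def proj_def by algebra
  qed
  have da: "(a has_real_derivative b \<psi>) (at \<psi> within X)" for \<psi> X
    unfolding a_def b_def proj_def by (auto intro!: derivative_eq_intros)
  have db: "(b has_real_derivative - a \<psi>) (at \<psi> within X)" for \<psi> X
    unfolding a_def b_def proj_def by (auto intro!: derivative_eq_intros)
  \<comment> \<open>The factor \<open>1 / (\<alpha>\<^sup>2 + |z|\<^sup>2)\<close> is the one that removes the double pole \<open>(\<alpha>\<^sup>2 + a\<^sup>2)\<^sup>2\<close> of the filter.\<close>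
  define F where "F = (\<lambda>\<psi>. 1 / (2 * pi\<^sup>2 * (\<alpha>\<^sup>2 + (norm z)\<^sup>2)) * (a \<psi> * b \<psi> / (\<alpha>\<^sup>2 + (a \<psi>)\<^sup>2)))"
  have dF: "(F has_real_derivative recon_filter \<alpha> (a \<psi>) - angular_poisson \<alpha> z \<psi>) (at \<psi> within X)" for \<psi> X
  proof -
    let ?Q = "\<alpha>\<^sup>2 + (a \<psi>)\<^sup>2" and ?R = "\<alpha>\<^sup>2 + (norm z)\<^sup>2"
    have "(F has_real_derivative 1 / (2 * pi\<^sup>2 * ?R) *
      (((b \<psi> * b \<psi> - a \<psi> * a \<psi>) * ?Q - a \<psi> * b \<psi> * (2 * a \<psi> * b \<psi>)) / (?Q * ?Q))) (at \<psi> within X)"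
      unfolding F_def using pos(1)[of \<psi>]
      by (intro DERIV_cmult DERIV_divide) (auto intro!: derivative_eq_intros da db)
    moreover have "(b \<psi> * b \<psi> - a \<psi> * a \<psi>) * ?Q - a \<psi> * b \<psi> * (2 * a \<psi> * b \<psi>)
        = (\<alpha>\<^sup>2 - (a \<psi>)\<^sup>2) * ?R - \<alpha>\<^sup>2 * ?Q"
      using pyth[of \<psi>] by algebra
    moreover have "1 / (2 * pi\<^sup>2 * ?R) * (((\<alpha>\<^sup>2 - (a \<psi>)\<^sup>2) * ?R - \<alpha>\<^sup>2 * ?Q) / (?Q * ?Q))
       = recon_filter \<alpha> (a \<psi>) - angular_poisson \<alpha> z \<psi>"
    proof -
      have "1 / (2 * P * R) * ((A * R - B * Q) / (Q * Q)) = 1 / (2 * P) * (A / Q\<^sup>2) - B / (2 * P * R * Q)"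
        if "P > 0" "R > 0" "Q > 0" for P R Q A B :: real
        using that by (simp add: field_simps power2_eq_square)
      from this[of "pi\<^sup>2" ?R ?Q] pos show ?thesis
        unfolding recon_filter_def angular_poisson_def a_def by simp
    qed
    ultimately show ?thesis by simp
  qed
  have cont: "continuous_on X (\<lambda>\<psi>. recon_filter \<alpha> (a \<psi>))" "continuous_on X (angular_poisson \<alpha> z)" for X
  proof -
    have "continuous_on X a"
      using da by (meson DERIV_continuous_on)
    moreover have "angular_poisson \<alpha> z = (\<lambda>\<psi>. \<alpha>\<^sup>2 / (2 * pi\<^sup>2 * (\<alpha>\<^sup>2 + (norm z)\<^sup>2) * (\<alpha>\<^sup>2 + (a \<psi>)\<^sup>2)))"
      by (auto simp: angular_poisson_def a_def)
    moreover have "\<alpha>\<^sup>2 + (a \<psi>)\<^sup>2 \<noteq> 0" "\<alpha>\<^sup>2 + (norm z)\<^sup>2 \<noteq> 0" for \<psi>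
      using pos(1)[of \<psi>] pos(2) by auto
    ultimately show "continuous_on X (\<lambda>\<psi>. recon_filter \<alpha> (a \<psi>))" "continuous_on X (angular_poisson \<alpha> z)"
      unfolding recon_filter_def by (auto intro!: continuous_intros)
  qed
  have "(LINT \<psi>:{0..pi}|lborel. recon_filter \<alpha> (a \<psi>) - angular_poisson \<alpha> z \<psi>) = F pi - F 0"
    unfolding set_lebesgue_integral_def
    by (rule integral_FTC_atLeastAtMost)
       (auto intro!: continuous_intros cont dF simp flip: has_real_derivative_iff_has_vector_derivative)
  also have "\<dots> = 0"
    by (simp add: F_def a_def b_def proj_def)
  also have "(LINT \<psi>:{0..pi}|lborel. recon_filter \<alpha> (a \<psi>) - angular_poisson \<alpha> z \<psi>)
    = (LINT \<psi>:{0..pi}|lborel. recon_filter \<alpha> (a \<psi>)) - (LINT \<psi>:{0..pi}|lborel. angular_poisson \<alpha> z \<psi>)"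
    by (intro set_integral_diff borel_integrable_atLeastAtMost' cont)
  finally show ?thesis
    by (simp add: poisson_kernel_def set_integral_drop_right_endpoint a_def)
qed

lemma set_integrable_angular_poisson:
  assumes "\<alpha> > 0"
  shows "set_integrable lborel {0..<pi} (angular_poisson \<alpha> z)"
proof (rule set_integrable_subset)
  have "\<alpha>\<^sup>2 + (norm z)\<^sup>2 \<noteq> 0" "\<alpha>\<^sup>2 + (proj \<psi> z)\<^sup>2 \<noteq> 0" for \<psi>
    using assms by (auto simp: add_nonneg_eq_0_iff)
  then have "continuous_on {0..pi} (angular_poisson \<alpha> z)"
    unfolding angular_poisson_def proj_def by (auto intro!: continuous_intros)
  then show "set_integrable lborel {0..pi} (angular_poisson \<alpha> z)"
    by (rule borel_integrable_atLeastAtMost')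
qed auto

text \<open>
  Rotating by \<open>\<psi>\<close> turns \<open>proj \<psi>\<close> into the first coordinate \<open>t\<close> and preserves the norm.  The integral
  over the second coordinate is then an arctangent integral with value \<open>\<pi> / sqrt (\<alpha>\<^sup>2 + t\<^sup>2)\<close>.
\<close>

lemma nn_integral_angular_poisson:
  assumes "\<alpha> > 0" "0 \<le> \<psi>" "\<psi> < pi"
  shows "(\<integral>\<^sup>+z. ennreal (angular_poisson \<alpha> z \<psi>) \<partial>lborel) = ennreal (1 / pi)"
proof -
  have [measurable]: "(\<lambda>z. angular_poisson \<alpha> z \<psi>) \<in> borel_measurable borel"
    by measurable
  have pos: "\<alpha>\<^sup>2 + t\<^sup>2 > 0" for t using assms by (simp add: add_pos_nonneg)
  let ?c = "\<lambda>t. \<alpha>\<^sup>2 / (2 * pi\<^sup>2 * (\<alpha>\<^sup>2 + t\<^sup>2))"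
  have "(\<integral>\<^sup>+z. ennreal (angular_poisson \<alpha> z \<psi>) \<partial>lborel)
      = (\<integral>\<^sup>+z. ennreal (angular_poisson \<alpha> z \<psi>) \<partial>distr lborel borel (rotation \<psi>))"
    using lborel_rotation[OF assms(2,3)] by simp
  also have "\<dots> = (\<integral>\<^sup>+p. ennreal (angular_poisson \<alpha> (rotation \<psi> p) \<psi>) \<partial>lborel)"
    by (rule nn_integral_distr) auto
  also have "\<dots> = (\<integral>\<^sup>+p. ennreal (?c (fst p)) * ennreal (1 / ((sqrt (\<alpha>\<^sup>2 + (fst p)\<^sup>2))\<^sup>2 + (snd p)\<^sup>2)) \<partial>lborel)"
    unfolding angular_poisson_def proj_rotation norm_rotation
    using pos by (intro nn_integral_cong) (simp add: norm_prod_def ennreal_mult[symmetric] less_imp_le add.assoc mult_ac)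
  also have "\<dots> = (\<integral>\<^sup>+t. \<integral>\<^sup>+u. ennreal (?c t) * ennreal (1 / ((sqrt (\<alpha>\<^sup>2 + t\<^sup>2))\<^sup>2 + u\<^sup>2)) \<partial>lborel \<partial>lborel)"
    by (subst lborel_prod[symmetric], subst lborel.nn_integral_fst[symmetric]) auto
  also have "\<dots> = (\<integral>\<^sup>+t. ennreal (?c t) * ennreal (pi / sqrt (\<alpha>\<^sup>2 + t\<^sup>2)) \<partial>lborel)"
    using pos by (simp add: nn_integral_cmult nn_integral_inverse_quadratic del: real_sqrt_pow2 real_sqrt_pow2_iff)
  also have "\<dots> = (\<integral>\<^sup>+t. ennreal (\<alpha>\<^sup>2 / (2 * pi)) * ennreal (1 / sqrt (\<alpha>\<^sup>2 + t\<^sup>2) ^ 3) \<partial>lborel)"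
  proof (intro nn_integral_cong)
    fix t :: real
    define s where "s = sqrt (\<alpha>\<^sup>2 + t\<^sup>2)"
    have s: "s > 0" "\<alpha>\<^sup>2 + t\<^sup>2 = s\<^sup>2" using pos[of t] by (auto simp: s_def)
    show "ennreal (?c t) * ennreal (pi / sqrt (\<alpha>\<^sup>2 + t\<^sup>2)) 
      = ennreal (\<alpha>\<^sup>2 / (2 * pi)) * ennreal (1 / sqrt (\<alpha>\<^sup>2 + t\<^sup>2) ^ 3)"
      unfolding s_def[symmetric] s(2) using s(1)
      by (simp add: ennreal_mult[symmetric] power2_eq_square power3_eq_cube mult_ac)
  qed
  also have "\<dots> = ennreal (\<alpha>\<^sup>2 / (2 * pi)) * ennreal (2 / \<alpha>\<^sup>2)"
    using assms(1) by (simp add: nn_integral_cmult nn_integral_inverse_cubed_hypotenuse)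
  also have "\<dots> = ennreal (1 / pi)"
    using assms(1) by (simp add: ennreal_mult[symmetric])
  finally show ?thesis .
qed

lemma nn_integral_poisson_kernel:
  assumes "\<alpha> > 0"
  shows "(\<integral>\<^sup>+z. ennreal (poisson_kernel \<alpha> z) \<partial>lborel) = 1"
proof -
  have "(\<integral>\<^sup>+z. ennreal (poisson_kernel \<alpha> z) \<partial>lborel)
     = (\<integral>\<^sup>+z. \<integral>\<^sup>+\<psi>. ennreal (angular_poisson \<alpha> z \<psi>) * indicator {0..<pi} \<psi> \<partial>lborel \<partial>lborel)"
  proof (intro nn_integral_cong)
    fix z
    have "ennreal (poisson_kernel \<alpha> z) = (\<integral>\<^sup>+\<psi>. ennreal (indicator {0..<pi} \<psi> *\<^sub>R angular_poisson \<alpha> z \<psi>) \<partial>lborel)"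
      unfolding poisson_kernel_def set_lebesgue_integral_def
      using set_integrable_angular_poisson[OF assms] 
      by (intro nn_integral_eq_integral[symmetric]) (auto simp: set_integrable_def)
    then show "ennreal (poisson_kernel \<alpha> z) = (\<integral>\<^sup>+\<psi>. ennreal (angular_poisson \<alpha> z \<psi>) * indicator {0..<pi} \<psi> \<partial>lborel)"
      by (auto intro!: nn_integral_cong split: split_indicator)
  qed
  also have "\<dots> = (\<integral>\<^sup>+\<psi>. \<integral>\<^sup>+z. ennreal (angular_poisson \<alpha> z \<psi>) * indicator {0..<pi} \<psi> \<partial>lborel \<partial>lborel)"
    by (rule lborel_pair.Fubini'[symmetric]) measurable
  also have "\<dots> = (\<integral>\<^sup>+\<psi>. ennreal (1 / pi) * indicator {0..<pi} \<psi> \<partial>lborel)"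
    using nn_integral_angular_poisson[OF assms] 
    by (intro nn_integral_cong) (auto split: split_indicator)
  also have "\<dots> = 1"
    by (simp add: nn_integral_cmult_indicator ennreal_mult[symmetric])
  finally show ?thesis .
qed

lemma poisson_kernel_translate_mass:
  assumes "\<alpha> > 0"
  shows "integrable lebesgue (\<lambda>y. poisson_kernel \<alpha> (x - y))"
    and "(LINT y|lebesgue. poisson_kernel \<alpha> (x - y)) = 1"
proof -
  have "(\<integral>\<^sup>+y. ennreal (poisson_kernel \<alpha> (x - y)) \<partial>lborel)
      = (\<integral>\<^sup>+z. ennreal (poisson_kernel \<alpha> z) \<partial>distr lborel borel (\<lambda>y. x + - 1 *\<^sub>R y))"
    by (subst nn_integral_distr) auto
  also have "distr lborel borel (\<lambda>y. x + - 1 *\<^sub>R y) = (lborel :: (real \<times> real) measure)"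
    using lborel_affine[of "-1" x] by (simp add: density_1)
  finally have 1: "(\<integral>\<^sup>+y. ennreal (poisson_kernel \<alpha> (x - y)) \<partial>lborel) = 1"
    using nn_integral_poisson_kernel[OF assms] by simp
  have "integrable lborel (\<lambda>y. poisson_kernel \<alpha> (x - y))"
    by (rule integrableI_nonneg) (auto simp: 1 poisson_kernel_nonneg)
  moreover have "(LINT y|lborel. poisson_kernel \<alpha> (x - y)) = 1"
    by (subst integral_eq_nn_integral) (auto simp: 1 poisson_kernel_nonneg)
  ultimately show "integrable lebesgue (\<lambda>y. poisson_kernel \<alpha> (x - y))" "(LINT y|lebesgue. poisson_kernel \<alpha> (x - y)) = 1"
    by (simp_all add: integrable_completion integral_completion)
qed

section \<open>The operator as a convolution\<close>

text \<open>
  Product measures of completed measures are not complete, so Fubini's theorem is applied to a Borel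
  representative of \<open>f\<close>; the next two lemmas provide it and transfer integrals.
\<close>

lemma lebesgue_borel_representative:
  fixes f :: "'a::euclidean_space \<Rightarrow> complex"
  assumes "f \<in> borel_measurable lebesgue"
  obtains g where "g \<in> borel_measurable borel" "AE x in lborel. f x = g x"
proof -
  have "(\<lambda>x. Re (f x)) \<in> borel_measurable lebesgue" "(\<lambda>x. Im (f x)) \<in> borel_measurable lebesgue"
    using assms by measurable
  from this[THEN completion_ex_borel_measurable_real]
  obtain u v where [measurable]: "u \<in> borel_measurable lborel" "v \<in> borel_measurable lborel"
    and ae: "AE x in lborel. Re (f x) = u x" "AE x in lborel. Im (f x) = v x"
    by blast
  show thesis
  proof
    show "(\<lambda>x. Complex (u x) (v x)) \<in> borel_measurable borel"
      unfolding Complex_eq by measurable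
    show "AE x in lborel. f x = Complex (u x) (v x)"
      using ae by eventually_elim (simp add: complex_eq_iff)
  qed
qed

lemma lebesgue_integral_AE_eq_borel:
  fixes f g :: "'a::euclidean_space \<Rightarrow> 'b::euclidean_space"
  assumes g: "g \<in> borel_measurable borel" and ae: "AE x in lborel. f x = g x"
  shows "integral\<^sup>L lebesgue f = integral\<^sup>L lborel g"
    and "integrable lebesgue f \<longleftrightarrow> integrable lborel g"
proof -
  have g': "g \<in> borel_measurable lborel" "g \<in> borel_measurable lebesgue"
    using g by (auto intro: measurable_completion)
  have ae': "AE x in lebesgue. g x = f x"
    using ae by (intro AE_completion) auto
  have f: "f \<in> borel_measurable lebesgue"
    using borel_measurable_AE[OF g'(2) ae'] .
  show "integral\<^sup>L lebesgue f = integral\<^sup>L lborel g"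
    using integral_cong_AE[OF g'(2) f ae'] integral_completion[OF g'(1)] by simp
  show "integrable lebesgue f \<longleftrightarrow> integrable lborel g"
    using integrable_cong_AE[OF g'(2) f ae'] integrable_completion[OF g'(1)] by simp
qed

lemma norm_recon_filter_times_le:
  fixes w :: complex
  assumes "\<alpha> > 0"
  shows "norm (complex_of_real (recon_filter \<alpha> s) * w) \<le> 1 / (2 * pi\<^sup>2 * \<alpha>\<^sup>2) * norm w"
  unfolding norm_mult norm_of_real
  by (rule mult_right_mono[OF abs_recon_filter_le[OF assms] norm_ge_zero])

lemma integrable_recon_filter_times:
  fixes g :: "real \<times> real \<Rightarrow> complex"
  assumes "\<alpha> > 0" and "integrable lborel g"
  shows "integrable lborel (\<lambda>y. complex_of_real (recon_filter \<alpha> (proj \<psi> (x - y))) * g y)"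
proof (rule Bochner_Integration.integrable_bound)
  show "integrable lborel (\<lambda>y. 1 / (2 * pi\<^sup>2 * \<alpha>\<^sup>2) * norm (g y))"
    using assms(2) by simp
  show "AE y in lborel. norm (complex_of_real (recon_filter \<alpha> (proj \<psi> (x - y))) * g y)
      \<le> norm (1 / (2 * pi\<^sup>2 * \<alpha>\<^sup>2) * norm (g y))"
    using norm_recon_filter_times_le[OF assms(1)] by (intro AE_I2) (auto intro: order.trans[OF _ abs_ge_self])
qed (use assms(2) in measurable)

text \<open>
  The point \<open>rotation \<psi> (t, u)\<close> is the one with parameter \<open>u\<close> on the line of the Radon transform at
  \<open>(t, \<psi>)\<close>, and its projection to the direction \<open>\<psi>\<close> is \<open>t\<close>.  Hence \<open>\<Phi>_\<alpha>(x, t, \<psi>)\<close> does not depend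
  on \<open>u\<close> and can be moved under the line integral.  Changing \<open>f\<close> on a null set of the plane changes
  it, for almost every \<open>t\<close>, only on a null set of the line.
\<close>

lemma filtered_radon_eq_plane_integral:
  fixes f g :: "real \<times> real \<Rightarrow> complex"
  assumes \<alpha>: "\<alpha> > 0" and \<psi>: "0 \<le> \<psi>" "\<psi> < pi"
    and g: "integrable lborel g" and fg: "AE y in lborel. f y = g y"
  shows "(LINT t|lebesgue. complex_of_real (Phi \<alpha> x t \<psi>) * radon f t \<psi>)
       = (LINT y|lborel. complex_of_real (recon_filter \<alpha> (proj \<psi> (x - y))) * g y)"
proof -
  define H where "H = (\<lambda>y. complex_of_real (recon_filter \<alpha> (proj \<psi> (x - y))) * g y)"
  have [measurable]: "g \<in> borel_measurable borel"
    using g by auto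
  have [measurable]: "H \<in> borel_measurable borel"
    unfolding H_def by measurable
  have H: "integrable lborel H"
    unfolding H_def by (rule integrable_recon_filter_times[OF \<alpha> g])
  have HR: "H (rotation \<psi> (t, u)) = complex_of_real (Phi \<alpha> x t \<psi>) * g (rotation \<psi> (t, u))" for t u
    by (simp add: H_def proj_diff Phi_eq_recon_filter)
  have intHR: "integrable (lborel \<Otimes>\<^sub>M lborel) (\<lambda>p. H (rotation \<psi> p))"
    using H lborel_rotation[OF \<psi>] unfolding lborel_prod
    by (subst integrable_distr_eq[of "rotation \<psi>" lborel borel, symmetric]) auto
  have [measurable]: "(\<lambda>p. g (rotation \<psi> p)) \<in> borel_measurable (borel \<Otimes>\<^sub>M borel)"
    unfolding borel_prod by measurable
  have "AE p in distr lborel borel (rotation \<psi>). f p = g p"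
    using fg by (simp only: lborel_rotation[OF \<psi>])
  then have "AE p in lborel. f (rotation \<psi> p) = g (rotation \<psi> p)"
    by (intro AE_distrD[of "rotation \<psi>" lborel borel]) auto
  then have "AE t in lborel. AE u in lborel. f (rotation \<psi> (t, u)) = g (rotation \<psi> (t, u))"
    unfolding lborel_prod[symmetric] by (rule lborel_pair.AE_pair)
  then have "AE t in lborel. complex_of_real (Phi \<alpha> x t \<psi>) * radon f t \<psi>
     = (LINT u|lborel. H (rotation \<psi> (t, u)))"
  proof eventually_elim
    case (elim t)
    have pair_t: "(\<lambda>u. (t, u)) \<in> borel_measurable borel"
      by (intro borel_measurable_continuous_onI continuous_intros)
    have "radon f t \<psi> = (LINT u|lebesgue. f (rotation \<psi> (t, u)))"
      by (simp add: radon_def rotation_def)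
    also have "\<dots> = (LINT u|lborel. g (rotation \<psi> (t, u)))"
      by (rule lebesgue_integral_AE_eq_borel(1)[OF measurable_compose[OF pair_t] elim]) measurable
    finally show ?case
      by (simp add: HR)
  qed
  then have "(LINT t|lebesgue. complex_of_real (Phi \<alpha> x t \<psi>) * radon f t \<psi>)
    = (LINT t|lborel. LINT u|lborel. H (rotation \<psi> (t, u)))"
    by (intro lebesgue_integral_AE_eq_borel) (simp_all add: HR Phi_eq_recon_filter)
  also have "\<dots> = (LINT p|lborel. H (rotation \<psi> p))"
    using lborel_pair.integral_fst'[OF intHR] by (simp add: lborel_prod)
  also have "\<dots> = (LINT y|lborel. H y)"
    using lborel_rotation[OF \<psi>] integral_distr[of "rotation \<psi>" lborel borel H] by simp
  finally show ?thesis by (simp add: H_def)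
qed

text \<open>
  The filter is bounded and the range of directions has finite length, so
  \<open>recon_filter \<alpha> (proj \<psi> (x - y)) * f y\<close> is jointly integrable and the order of integration can be
  exchanged.
\<close>

theorem A_op_eq_poisson_convolution:
  assumes \<alpha>: "\<alpha> > 0" and f: "integrable lebesgue f"
  shows "A_op \<alpha> f x = (LINT y|lebesgue. complex_of_real (poisson_kernel \<alpha> (x - y)) * f y)"
proof -
  obtain g where g [measurable]: "g \<in> borel_measurable borel" and fg: "AE y in lborel. f y = g y"
    using lebesgue_borel_representative f borel_measurable_integrable by blast
  have intg: "integrable lborel g"
    using lebesgue_integral_AE_eq_borel(2)[OF g fg] f by simp
  let ?K = "\<lambda>\<psi> y. complex_of_real (recon_filter \<alpha> (proj \<psi> (x - y))) * g y"
  have [measurable]: "(\<lambda>(\<psi>, y). ?K \<psi> y) \<in> borel_measurable (borel \<Otimes>\<^sub>M borel)"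
    by measurable
  have int: "integrable (lborel \<Otimes>\<^sub>M lborel) (\<lambda>(\<psi>, y). indicator {0..<pi} \<psi> *\<^sub>R ?K \<psi> y)"
  proof (rule lborel_pair.Fubini_integrable)
    show "integrable lborel (\<lambda>\<psi>. LINT y|lborel. norm ((\<lambda>(\<psi>, y). indicator {0..<pi} \<psi> *\<^sub>R ?K \<psi> y) (\<psi>, y)))"
    proof (rule Bochner_Integration.integrable_bound)
      let ?M = "1 / (2 * pi\<^sup>2 * \<alpha>\<^sup>2) * (LINT y|lborel. norm (g y))"
      show "integrable lborel (\<lambda>\<psi>. indicator {0..<pi} \<psi> * ?M :: real)"
        by (intro integrable_mult_left integrable_real_indicator) auto
      have "(LINT y|lborel. norm (?K \<psi> y)) \<le> ?M" for \<psi>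
      proof -
        have "(LINT y|lborel. norm (?K \<psi> y)) \<le> (LINT y|lborel. 1 / (2 * pi\<^sup>2 * \<alpha>\<^sup>2) * norm (g y))"
          using integrable_recon_filter_times[OF \<alpha> intg] intg
          by (intro integral_mono integrable_norm norm_recon_filter_times_le[OF \<alpha>]) auto
        then show ?thesis by simp
      qed
      then show "AE \<psi> in lborel. norm (LINT y|lborel. norm ((\<lambda>(\<psi>, y). indicator {0..<pi} \<psi> *\<^sub>R ?K \<psi> y) (\<psi>, y)))
          \<le> norm (indicator {0..<pi} \<psi> * ?M)"
        by (intro AE_I2) (auto split: split_indicator simp: order.trans[OF _ abs_ge_self])
    qed measurable
    show "AE \<psi> in lborel. integrable lborel (\<lambda>y. (\<lambda>(\<psi>, y). indicator {0..<pi} \<psi> *\<^sub>R ?K \<psi> y) (\<psi>, y))"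
      using integrable_recon_filter_times[OF \<alpha> intg] by simp
  qed measurable
  have "A_op \<alpha> f x = (LINT \<psi>|lebesgue. indicator {0..<pi} \<psi> *\<^sub>R (LINT y|lborel. ?K \<psi> y))"
    unfolding A_op_def set_lebesgue_integral_def
    using filtered_radon_eq_plane_integral[OF \<alpha> _ _ intg fg]
    by (intro Bochner_Integration.integral_cong) (auto split: split_indicator)
  also have "\<dots> = (LINT \<psi>|lborel. LINT y|lborel. indicator {0..<pi} \<psi> *\<^sub>R ?K \<psi> y)"
    by (subst integral_completion) auto
  also have "\<dots> = (LINT y|lborel. LINT \<psi>|lborel. indicator {0..<pi} \<psi> *\<^sub>R ?K \<psi> y)"
    by (rule lborel_pair.Fubini_integral[symmetric]) (use int in \<open>simp add: case_prod_unfold\<close>)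
  also have "\<dots> = (LINT y|lborel. complex_of_real (poisson_kernel \<alpha> (x - y)) * g y)"
  proof (intro Bochner_Integration.integral_cong refl)
    fix y
    have "(LINT \<psi>|lborel. indicator {0..<pi} \<psi> *\<^sub>R ?K \<psi> y)
      = (LINT \<psi>|lborel. complex_of_real (indicator {0..<pi} \<psi> *\<^sub>R recon_filter \<alpha> (proj \<psi> (x - y))) * g y)"
      by (intro Bochner_Integration.integral_cong) (auto split: split_indicator)
    also have "\<dots> = complex_of_real (LINT \<psi>:{0..<pi}|lborel. recon_filter \<alpha> (proj \<psi> (x - y))) * g y"
      unfolding set_lebesgue_integral_def integral_mult_left_zero integral_complex_of_real ..
    finally show "(LINT \<psi>|lborel. indicator {0..<pi} \<psi> *\<^sub>R ?K \<psi> y)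
      = complex_of_real (poisson_kernel \<alpha> (x - y)) * g y"
      by (simp only: set_integral_recon_filter_proj[OF \<alpha>])
  qed
  also have "\<dots> = (LINT y|lebesgue. complex_of_real (poisson_kernel \<alpha> (x - y)) * f y)"
    using fg by (intro lebesgue_integral_AE_eq_borel(1)[symmetric]) auto
  finally show ?thesis .
qed

section \<open>Bounds for the operator\<close>

theorem theorem1p2:
  fixes f :: "real \<times> real \<Rightarrow> complex" and \<alpha> :: real
  assumes "integrable lebesgue f"
    and "piecewise_smooth f"
    and "\<alpha> > 0"
  shows "(\<forall>C::real. (\<forall>x. norm (f x) < C) \<longrightarrow> (\<forall>x. norm (A_op \<alpha> f x) \<le> C)) \<and>
         (\<forall>A B::real. (\<forall>x. f x \<in> \<real> \<and> A \<le> Re (f x) \<and> Re (f x) \<le> B) \<longrightarrow>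
            (\<forall>x. A_op \<alpha> f x \<in> \<real> \<and> A \<le> Re (A_op \<alpha> f x) \<and> Re (A_op \<alpha> f x) \<le> B))"
proof (intro conjI allI impI)
  note conv = A_op_eq_poisson_convolution[OF assms(3,1)]
  note mass = poisson_kernel_translate_mass[OF assms(3)]
  have [measurable]: "f \<in> borel_measurable lebesgue"
    using assms(1) by (rule borel_measurable_integrable)
  have [measurable]: "(\<lambda>y. poisson_kernel \<alpha> (x - y)) \<in> borel_measurable lebesgue" for x
    using mass(1) by (rule borel_measurable_integrable)
  have dominated: "integrable lebesgue (\<lambda>y. complex_of_real (poisson_kernel \<alpha> (x - y)) * f y) \<and>
      norm (A_op \<alpha> f x) \<le> C" if C: "\<And>y. norm (f y) \<le> C" for C x
  proof -
    have le: "norm (complex_of_real (poisson_kernel \<alpha> (x - y)) * f y) \<le> poisson_kernel \<alpha> (x - y) * C" for y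
      using C poisson_kernel_nonneg[of \<alpha> "x - y"] by (simp add: norm_mult mult_left_mono)
    have intC: "integrable lebesgue (\<lambda>y. poisson_kernel \<alpha> (x - y) * C)"
      using mass(1) by simp
    have int: "integrable lebesgue (\<lambda>y. complex_of_real (poisson_kernel \<alpha> (x - y)) * f y)"
    proof (rule Bochner_Integration.integrable_bound[OF intC])
      show "AE y in lebesgue. norm (complex_of_real (poisson_kernel \<alpha> (x - y)) * f y)
          \<le> norm (poisson_kernel \<alpha> (x - y) * C)"
        using le by (intro AE_I2) (auto intro: order.trans[OF _ abs_ge_self])
    qed measurable
    have "norm (A_op \<alpha> f x) \<le> (LINT y|lebesgue. poisson_kernel \<alpha> (x - y) * C)"
      unfolding conv by (rule Bochner_Integration.integral_norm_bound_integral[OF int intC le])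
    also have "\<dots> = C"
      using mass(2) by simp
    finally show ?thesis using int by simp
  qed
  show "norm (A_op \<alpha> f x) \<le> C" if "\<forall>y. norm (f y) < C" for C x
    using dominated[of C x] that less_imp_le by blast
  fix A B :: real and x
  assume AB: "\<forall>y. f y \<in> \<real> \<and> A \<le> Re (f y) \<and> Re (f y) \<le> B"
  have f: "f y = complex_of_real (Re (f y))" for y
    using AB[rule_format, of y] by (simp add: complex_is_Real_iff complex_eq_iff)
  have bounds: "A \<le> Re (f y)" "Re (f y) \<le> B" for y
    using AB by blast+
  \<comment> \<open>A crude bound on \<open>f\<close>, for the existence of the convolution integral.\<close>
  have "norm (f y) \<le> \<bar>A\<bar> + \<bar>B\<bar>" for y
  proof -
    have "norm (f y) = \<bar>Re (f y)\<bar>"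
      using f[of y] by (metis norm_of_real)
    then show ?thesis using bounds[of y] by linarith
  qed
  then have "integrable lebesgue (\<lambda>y. complex_of_real (poisson_kernel \<alpha> (x - y)) * f y)"
    using dominated by blast
  then have int: "integrable lebesgue (\<lambda>y. poisson_kernel \<alpha> (x - y) * Re (f y))"
    by (drule_tac integrable_Re) simp
  have eq: "A_op \<alpha> f x = complex_of_real (LINT y|lebesgue. poisson_kernel \<alpha> (x - y) * Re (f y))"
    unfolding conv integral_complex_of_real[symmetric]
    by (intro Bochner_Integration.integral_cong refl) (metis f of_real_mult)
  have "(LINT y|lebesgue. poisson_kernel \<alpha> (x - y) * A) \<le> (LINT y|lebesgue. poisson_kernel \<alpha> (x - y) * Re (f y))"
    using mass(1) int by (intro integral_mono mult_left_mono poisson_kernel_nonneg bounds) simp_all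
  moreover have "(LINT y|lebesgue. poisson_kernel \<alpha> (x - y) * Re (f y)) \<le> (LINT y|lebesgue. poisson_kernel \<alpha> (x - y) * B)"
    using mass(1) int by (intro integral_mono mult_left_mono poisson_kernel_nonneg bounds) simp_all
  ultimately show "A_op \<alpha> f x \<in> \<real>" "A \<le> Re (A_op \<alpha> f x)" "Re (A_op \<alpha> f x) \<le> B"
    using mass(2) by (simp_all add: eq)
qed

end
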